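(* Let $G=(V,E)$ be a finite, connected, undirected graph with $|V|\ge 2$ and let $\pi \in \mathcal D(V)$. Let $\varepsilon\in(0,1)$ and $P \in \mathcal M(G,\pi)$. Then there exist $\pi' \in \mathcal D(\pi,\varepsilon)$ and $Q \in \mathcal M(G,\pi')$ such that $$ \gamma_Q \;\ge\; \tfrac{1}{12}\,\varepsilon\,(\operatorname{diam} G)^{-2} \qquad\text{and}\qquad \pi'(x)Q(x,y) \;\ge\; (1-\varepsilon)\,\pi(x)P(x,y)\quad\text{for all } \{x,y\}\in E. $$ Consequently, $$ \tau_Q \;\le\; 24\,\varepsilon^{-1}(\operatorname{diam} G)^2\log\bigl(16\,\pi_{\min}^{-1}\bigr),\qquad \pi_{\min} := \min_{x\in V}\pi(x). $$
   Context: $\mathcal D(V)$ is the set of positive probability distributions on $V$; for $\pi\in\mathcal D(V)$ and $\varepsilon\in[0,1]$, $\mathcal D(\pi,\varepsilon) := \{\pi'\in\mathcal D(V) : \min_{x\in V}\pi'(x)/\pi(x)\ge 1-\varepsilon\}$. A transition matrix $P \in [0,1]^{V\times V}$ is on $G=(V,E)$ if $P(u,v) > 0$ implies $\{u,v\}\in E$ or $u=v$. It is lazy if $P(v,v) \ge 1/2$ for all $v$, and reversible with respect to $\pi$ if $\pi(u)P(u,v) = \pi(v)P(v,u)$ for all $u,v$. $\mathcal M(G,\pi)$ is the set of lazy transition matrices on $G$ reversible with respect to $\pi$. The spectral gap of $P$ is $\gamma_P := 1-\lambda_P$, where $\lambda_P$ is the second largest eigenvalue of $P$, counted with multiplicity.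 For $Q\in\mathcal M(G,\pi')$, the (uniform) mixing time is $\tau_Q(\xi) := \inf\{t\ge 0 : d_Q^\infty(t)\le \xi\}$ ($t$ integer), where $d_Q^\infty(t) := \max_{x,y\in V}|Q^t(x,y)/\pi'(y)-1|$ is the $\ell_\infty$-distance to equilibrium, and $\tau_Q := \tau_Q(1/4)$. $\operatorname{diam} G$ is the graph diameter. *)

theory Defs
  imports
    "HOL-Analysis.Analysis"
    "HOL-Computational_Algebra.Polynomial"
    "HOL-Library.Extended_Nat"
    "HOL-Library.Extended_Real"
    "Graph_Theory.Pair_Digraph"
    "Graph_Theory.Digraph_Component"
    "Graph_Theory.Shortest_Path"
begin

text \<open>
  The vertex set is the universe of a finite type. A finite simple undirected graph is a
  \<open>pair_graph\<close>, i.e. a finite, loop-free, symmetric set of ordered pairs: the edge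
  \<open>{x, y}\<close> is represented by the two arcs \<open>(x, y)\<close> and \<open>(y, x)\<close>.
\<close>

definition graph_dist :: "'v pair_pre_digraph \<Rightarrow> 'v \<Rightarrow> 'v \<Rightarrow> ereal" where
  "graph_dist G u v = wf_digraph.\<mu> (with_proj G) (\<lambda>_. 1) u v"

text \<open>
  On a connected finite graph all distances are finite, so the conversion to \<open>real\<close>
  loses nothing there; it would send an infinite diameter to 0.
\<close>

definition graph_diam :: "'v pair_pre_digraph \<Rightarrow> real" where
  "graph_diam G = real_of_ereal (SUP u\<in>pverts G. SUP v\<in>pverts G. graph_dist G u v)"

definition pos_distributions :: "('v::finite \<Rightarrow> real) set" where
  "pos_distributions = {\<pi>. (\<forall>x. \<pi> x > 0) \<and> (\<Sum>x\<in>UNIV. \<pi> x) = 1}"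

definition perturbed_distributions :: "('v::finite \<Rightarrow> real) \<Rightarrow> real \<Rightarrow> ('v \<Rightarrow> real) set" where
  "perturbed_distributions \<pi> \<epsilon> = {\<pi>' \<in> pos_distributions. (MIN x. \<pi>' x / \<pi> x) \<ge> 1 - \<epsilon>}"

definition transition_matrix :: "real^'v^'v \<Rightarrow> bool" where
  "transition_matrix P \<longleftrightarrow>
     (\<forall>u v. P $ u $ v \<in> {0..1}) \<and> (\<forall>u. (\<Sum>v\<in>UNIV. P $ u $ v) = 1)"

definition on_graph :: "'v pair_pre_digraph \<Rightarrow> real^'v^'v \<Rightarrow> bool" where
  "on_graph G P \<longleftrightarrow> (\<forall>u v. P $ u $ v > 0 \<longrightarrow> (u, v) \<in> parcs G \<or> u = v)"

definition lazy :: "real^'v^'v \<Rightarrow> bool" where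
  "lazy P \<longleftrightarrow> (\<forall>v. P $ v $ v \<ge> 1 / 2)"

definition reversible :: "('v::finite \<Rightarrow> real) \<Rightarrow> real^'v^'v \<Rightarrow> bool" where
  "reversible \<pi> P \<longleftrightarrow> (\<forall>u v. \<pi> u * P $ u $ v = \<pi> v * P $ v $ u)"

definition lazy_reversible_chains ::
    "'v::finite pair_pre_digraph \<Rightarrow> ('v \<Rightarrow> real) \<Rightarrow> (real^'v^'v) set" where
  "lazy_reversible_chains G \<pi> =
     {P. transition_matrix P \<and> on_graph G P \<and> lazy P \<and> reversible \<pi> P}"

definition charpoly :: "real^'v^'v \<Rightarrow> real poly" where
  "charpoly A = det (mat [:0, 1:] - (\<chi> i j. [:A $ i $ j:]))"

text \<open>
  Only the real roots of the characteristic polynomial are listed. For a matrix that is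
  reversible with respect to a positive distribution these are all the eigenvalues, each
  with its multiplicity, so the list has one entry per vertex.
\<close>

definition eigenvalues_desc :: "real^'v^'v \<Rightarrow> real list" where
  "eigenvalues_desc A = rev (sorted_list_of_multiset (proots (charpoly A)))"

definition second_eigenvalue :: "real^'v^'v \<Rightarrow> real" where
  "second_eigenvalue A = eigenvalues_desc A ! 1"

definition spectral_gap :: "real^'v^'v \<Rightarrow> real" where
  "spectral_gap A = 1 - second_eigenvalue A"

text \<open>The operator \<open>^\<close> on the type of matrices is the entrywise power.\<close>

primrec matrix_power :: "real^'v^'v \<Rightarrow> nat \<Rightarrow> real^'v^'v" where
  "matrix_power A 0 = mat 1"
| "matrix_power A (Suc t) = A ** matrix_power A t"

definition uniform_dist_to_eq :: "real^'v^'v \<Rightarrow> ('v::finite \<Rightarrow> real) \<Rightarrow> nat \<Rightarrow> real" where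
  "uniform_dist_to_eq Q \<pi> t = (MAX x. MAX y. \<bar>matrix_power Q t $ x $ y / \<pi> y - 1\<bar>)"

text \<open>The mixing time is \<open>\<infinity>\<close> if the threshold is never reached.\<close>

definition mixing_time :: "real^'v^'v \<Rightarrow> ('v::finite \<Rightarrow> real) \<Rightarrow> real \<Rightarrow> enat" where
  "mixing_time Q \<pi> \<xi> = (INF t\<in>{t. uniform_dist_to_eq Q \<pi> t \<le> \<xi>}. enat t)"

end

theory Submission
  imports Defs
begin

text \<open>
  The chain is improved by reinforcing the edges of a spanning tree. Let $r$ be a vertex and $T$ a tree
  of shortest paths to $r$; its height $n$ is at most the diameter. Start from a $\pi$-random vertex, look
  at a uniformly chosen step among the first $n$ steps of its path in $T$ to the root, and let the random edge
  so obtained carry a fraction $\delta$ of the total conductance, half of it as holding probability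
  in order to stay lazy. The rest of the conductance is that of $P$, scaled by $1 - \delta$. Since a random
  edge has total mass 1, the stationary distribution $\pi'$ is a mixture of $\pi$ with weight
  $1 - \delta$ and of the laws of the ends of the random edge.

  The point is that both the reinforcement and the deviation of $f$ from $f(r)$ are expressed by the
  same paths. By Cauchy--Schwarz along a path, $(f(x) - f(r))^2$ is at most $n$ times the sum of the
  squared increments, that is, at most $n^2$ times their average over the steps; and this holds
  not only for the starting vertex but for every vertex of the path, so the mass that the
  reinforcement itself adds is controlled by the same quantity (\<open>ancestor_path_bounds\<close>). Hence the
  variance under $\pi'$ is at most $4 n^2 / \delta$ times the Dirichlet form: this is the Poincare inequality of
  \<open>reinforced_chain\<close>. With $\delta = \varepsilon / 2$ the constant is
  $\varepsilon / (8 n^2)$, and $\pi' \ge \pi / 2$ holds for every $\varepsilon < 1$, so that the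
  mixing bound involves $\pi_{\min}$ without a factor $1 - \varepsilon$.

  Two general facts turn the Poincare inequality into the conclusion. It bounds the second largest root of
  the characteristic polynomial, by means of an orthonormal eigenbasis for the weighted inner
  product (\<open>second_eigenvalue_le\<close>). And for a lazy chain, whose quadratic form is positive
  semidefinite, it implies that the matrix contracts the mean-zero functions, which gives
  exponential decay of the uniform distance (\<open>mixing_time_le\<close>).
\<close>

section \<open>Eigenbases of self-adjoint operators\<close>

text \<open>
  This is the Cauchy--Schwarz inequality for a positive semidefinite form $B$: apply it to
  $B(f + t g, f + t g)$ as a polynomial in $t$. The form may be degenerate, hence the case $c = 0$.
\<close>

lemma discriminant_le_of_nonneg:
  fixes a b c :: real
  assumes nonneg: "\<And>t. 0 \<le> a + 2 * b * t + c * t\<^sup>2"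
  shows "b\<^sup>2 \<le> a * c"
proof (cases "c = 0")
  case True
  have "b = 0"
  proof (rule ccontr)
    assume "b \<noteq> 0"
    then show False
      using nonneg[of "- (a + 1) / (2 * b)"] True by simp
  qed
  then show ?thesis using True by simp
next
  case False
  have "c > 0"
  proof (rule ccontr)
    assume "\<not> c > 0"
    then have "c < 0" using False by simp
    \<comment> \<open>far enough out that the leading term dominates the two others, and at least 1\<close>
    define t where "t = (\<bar>a\<bar> + 2 * \<bar>b\<bar> + 1) / (- c) + 1"
    have "0 \<le> (\<bar>a\<bar> + 2 * \<bar>b\<bar> + 1) / (- c)"
      using \<open>c < 0\<close> by (intro divide_nonneg_pos) auto
    then have t1: "t \<ge> 1" unfolding t_def by linarith
    have ct: "c * t = - (\<bar>a\<bar> + 2 * \<bar>b\<bar> + 1) + c"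
      using \<open>c < 0\<close> by (simp add: t_def field_simps)
    have "a + 2 * b * t + c * t\<^sup>2 = a + t * (2 * b + c * t)"
      by (simp add: power2_eq_square algebra_simps)
    also have "\<dots> \<le> a + t * (- (\<bar>a\<bar> + 1))"
      using t1 ct \<open>c < 0\<close> by (intro add_left_mono mult_left_mono) auto
    also have "\<dots> \<le> a + 1 * (- (\<bar>a\<bar> + 1))"
      using t1 by (intro add_left_mono mult_right_mono_neg) auto
    also have "\<dots> < 0" by simp
    finally show False using nonneg[of t] by simp
  qed
  then show ?thesis
    using nonneg[of "- b / c"] by (simp add: field_simps power2_eq_square)
qed

text \<open>
  A maximiser $x$ of the Rayleigh quotient on the unit sphere of $W$ is an eigenvector. With $c$ the
  maximum, the form $c \langle y, y\rangle - \langle y, f y\rangle$ is positive semidefinite on $W$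
  and vanishes at $x$; by Cauchy--Schwarz $x$ is then in the radical of the form on $W$, and as
  $c x - f x$ lies in $W$ it must be zero. Working inside an invariant subspace is what allows
  eigenvectors to be collected one after the other.
\<close>

lemma selfadjoint_has_eigenvector:
  fixes f :: "'a::euclidean_space \<Rightarrow> 'a"
  assumes lin: "linear f"
    and selfadj: "\<And>x y. f x \<bullet> y = x \<bullet> f y"
    and W: "subspace W" and invariant: "\<And>x. x \<in> W \<Longrightarrow> f x \<in> W"
    and nontrivial: "w \<in> W" "w \<noteq> 0"
  obtains x c where "x \<in> W" "norm x = 1" "f x = c *\<^sub>R x"
proof -
  let ?K = "W \<inter> sphere 0 1"
  have "compact ?K"
    using W by (intro closed_Int_compact closed_subspace) auto
  moreover have "w /\<^sub>R norm w \<in> ?K"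
    using nontrivial W by (simp add: subspace_scale)
  moreover have "continuous_on ?K (\<lambda>x. x \<bullet> f x)"
    by (intro continuous_intros linear_continuous_on linear_conv_bounded_linear[THEN iffD1] lin)
  ultimately obtain x where x: "x \<in> ?K" and max: "\<And>y. y \<in> ?K \<Longrightarrow> y \<bullet> f y \<le> x \<bullet> f x"
    by (metis continuous_attains_sup empty_iff)
  define c where "c = x \<bullet> f x"
  have xW: "x \<in> W" and nx: "norm x = 1" using x by auto
  have form: "0 \<le> c * (y \<bullet> y) - y \<bullet> f y" if "y \<in> W" for y
  proof (cases "y = 0")
    case False
    have "y /\<^sub>R norm y \<in> ?K" using that False W by (simp add: subspace_scale)
    then have "(y /\<^sub>R norm y) \<bullet> f (y /\<^sub>R norm y) \<le> c" unfolding c_def by (rule max)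
    then have "(y \<bullet> f y) / (norm y)\<^sup>2 \<le> c"
      by (simp add: linear_scale[OF lin] power2_eq_square field_simps)
    then show ?thesis
      using False by (simp add: power2_norm_eq_inner field_simps)
  qed simp
  define v where "v = c *\<^sub>R x - f x"
  have vW: "v \<in> W" unfolding v_def using W xW invariant by (simp add: subspace_diff subspace_scale)
  have "(v \<bullet> v)\<^sup>2 \<le> 0 * (c * (v \<bullet> v) - v \<bullet> f v)"
  proof (rule discriminant_le_of_nonneg)
    fix t :: real
    have "x + t *\<^sub>R v \<in> W" using W xW vW by (simp add: subspace_add subspace_scale)
    from form[OF this]
    moreover have "x \<bullet> f v = f x \<bullet> v" by (simp only: selfadj)
    moreover have "v \<bullet> f x = f x \<bullet> v" "v \<bullet> x = x \<bullet> v" by (simp_all only: inner_commute)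
    ultimately have "0 \<le> (c * (x \<bullet> x) - x \<bullet> f x) + 2 * t * (c * (x \<bullet> v) - f x \<bullet> v)
              + (c * (v \<bullet> v) - v \<bullet> f v) * t\<^sup>2"
      by (simp add: linear_add[OF lin] linear_scale[OF lin] inner_add_left inner_add_right
          algebra_simps power2_eq_square)
    moreover have "c * (x \<bullet> x) - x \<bullet> f x = 0"
      using nx by (simp add: c_def norm_eq_1)
    moreover have "c * (x \<bullet> v) - f x \<bullet> v = v \<bullet> v"
      unfolding v_def
      by (simp add: inner_diff_left inner_diff_right inner_commute[of x "f x"] algebra_simps)
    ultimately show "0 \<le> 0 + 2 * (v \<bullet> v) * t + (c * (v \<bullet> v) - v \<bullet> f v) * t\<^sup>2"
      by (simp add: algebra_simps)
  qed
  then have "v = 0" by simp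
  then have "f x = c *\<^sub>R x" by (simp add: v_def)
  with xW nx show thesis by (rule that)
qed

text \<open>
  A largest orthonormal set of eigenvectors is a basis: otherwise its orthogonal complement is a
  nonzero subspace, invariant by self-adjointness, and contains one more unit eigenvector.
\<close>

theorem selfadjoint_orthonormal_eigenbasis:
  fixes f :: "'a::euclidean_space \<Rightarrow> 'a"
  assumes lin: "linear f" and selfadj: "\<And>x y. f x \<bullet> y = x \<bullet> f y"
  obtains B where "pairwise orthogonal B" "\<And>b. b \<in> B \<Longrightarrow> norm b = 1"
    "\<And>b. b \<in> B \<Longrightarrow> \<exists>c. f b = c *\<^sub>R b" "finite B" "card B = DIM('a)"
proof -
  define good where "good B \<longleftrightarrow>
    pairwise orthogonal B \<and> (\<forall>b\<in>B. norm b = 1 \<and> (\<exists>c. f b = c *\<^sub>R b))" for B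
  have indep: "independent B" if "good B" for B
    using that unfolding good_def by (intro pairwise_orthogonal_independent) auto
  have empty: "good {}" by (simp add: good_def)
  have bound: "\<forall>B. good B \<longrightarrow> card B < DIM('a) + 1"
    using indep independent_bound by fastforce
  obtain B where B: "good B" and max: "\<And>C. good C \<Longrightarrow> card C \<le> card B"
    using ex_has_greatest_nat[of good "{}" card, OF empty bound] by auto
  have fin: "finite B" using indep[OF B] independent_imp_finite by blast
  have "span B = UNIV"
  proof (rule ccontr)
    assume "span B \<noteq> UNIV"
    then obtain w where w: "w \<noteq> 0" "\<forall>x\<in>span B. w \<bullet> x = 0"
      using span_not_UNIV_orthogonal by blast
    let ?W = "{y. \<forall>x\<in>B. orthogonal x y}"
    have "w \<in> ?W" using w by (auto simp: orthogonal_def span_base inner_commute)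
    moreover have "f y \<in> ?W" if "y \<in> ?W" for y
    proof -
      have "b \<bullet> f y = 0" if "b \<in> B" for b
      proof -
        have "\<exists>c. f b = c *\<^sub>R b" using B that by (simp add: good_def)
        then obtain c where "f b = c *\<^sub>R b" ..
        then show ?thesis using \<open>y \<in> ?W\<close> that selfadj[of b y] by (simp add: orthogonal_def)
      qed
      then show ?thesis by (simp add: orthogonal_def)
    qed
    ultimately obtain x c where x: "x \<in> ?W" "norm x = 1" "f x = c *\<^sub>R x"
      using selfadjoint_has_eigenvector[OF lin selfadj subspace_orthogonal_to_vectors[of B], of w]
        w(1) by blast
    have "x \<notin> B" using x by (auto simp: orthogonal_def)
    moreover have "good (insert x B)"
      using B x unfolding good_def
      by (auto simp: pairwise_insert orthogonal_commute)
    ultimately show False using max[of "insert x B"] fin by simp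
  qed
  then have "card B = DIM('a)"
    using indep[OF B] by (metis dim_UNIV dim_span_eq_card_independent)
  then show thesis using that B fin unfolding good_def by blast
qed

section \<open>The second eigenvalue of a reversible matrix\<close>

definition weighted_inner :: "('v::finite \<Rightarrow> real) \<Rightarrow> real^'v \<Rightarrow> real^'v \<Rightarrow> real" where
  "weighted_inner \<pi> f g = (\<Sum>x\<in>UNIV. \<pi> x * f $ x * g $ x)"

lemma weighted_inner_commute: "weighted_inner \<pi> f g = weighted_inner \<pi> g f"
  by (simp add: weighted_inner_def mult_ac)

lemma weighted_inner_add_left:
  "weighted_inner \<pi> (f + g) h = weighted_inner \<pi> f h + weighted_inner \<pi> g h"
  by (simp add: weighted_inner_def algebra_simps sum.distrib)

lemma weighted_inner_scale_left:
  "weighted_inner \<pi> (c *\<^sub>R f) h = c * weighted_inner \<pi> f h"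
  by (simp add: weighted_inner_def algebra_simps sum_distrib_left)

lemma weighted_inner_add_right:
  "weighted_inner \<pi> h (f + g) = weighted_inner \<pi> h f + weighted_inner \<pi> h g"
  by (simp add: weighted_inner_def algebra_simps sum.distrib)

lemma weighted_inner_scale_right:
  "weighted_inner \<pi> h (c *\<^sub>R f) = c * weighted_inner \<pi> h f"
  by (simp add: weighted_inner_def algebra_simps sum_distrib_left)

lemmas weighted_inner_simps =
  weighted_inner_add_left weighted_inner_scale_left
  weighted_inner_add_right weighted_inner_scale_right

text \<open>
  Reversibility says that $S(x,y) = \sqrt{\pi(x)}\, Q(x,y) / \sqrt{\pi(y)}$ is symmetric. Dividing an
  orthonormal eigenbasis of $S$ entrywise by $\sqrt{\pi}$ gives eigenvectors of $Q$ that are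
  orthonormal for the $\pi$-weighted inner product.
\<close>

lemma reversible_eigenbasis:
  fixes Q :: "real^'v::finite^'v"
  assumes pos: "\<And>x. \<pi> x > 0" and rev: "reversible \<pi> Q"
  obtains \<phi> :: "'v \<Rightarrow> real^'v" and d :: "'v \<Rightarrow> real"
  where "\<And>i j. weighted_inner \<pi> (\<phi> i) (\<phi> j) = (if i = j then 1 else 0)"
    and "\<And>i. Q *v \<phi> i = d i *\<^sub>R \<phi> i"
proof -
  define S :: "real^'v^'v" where "S = (\<chi> x y. sqrt (\<pi> x) * Q $ x $ y / sqrt (\<pi> y))"
  have pos': "sqrt (\<pi> x) > 0" for x using pos by simp
  have sq: "sqrt (\<pi> x) * sqrt (\<pi> x) = \<pi> x" for x using pos[of x] by simp
  have sym: "S $ x $ y = S $ y $ x" for x y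
  proof -
    have "(sqrt (\<pi> x) * sqrt (\<pi> x)) * Q $ x $ y = (sqrt (\<pi> y) * sqrt (\<pi> y)) * Q $ y $ x"
      unfolding sq using rev by (simp add: reversible_def)
    then have "sqrt (\<pi> x) * Q $ x $ y * sqrt (\<pi> x) = sqrt (\<pi> y) * Q $ y $ x * sqrt (\<pi> y)"
      by (simp only: mult_ac)
    then show ?thesis using pos'[of x] pos'[of y] by (simp only: S_def vec_lambda_beta frac_eq_eq)
  qed
  have selfadj: "(S *v f) \<bullet> g = f \<bullet> (S *v g)" for f g
  proof -
    have "(S *v f) \<bullet> g = (\<Sum>x\<in>UNIV. \<Sum>y\<in>UNIV. S $ x $ y * f $ y * g $ x)"
      by (simp add: inner_vec_def matrix_vector_mult_def sum_distrib_right)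
    also have "\<dots> = (\<Sum>y\<in>UNIV. \<Sum>x\<in>UNIV. S $ x $ y * f $ y * g $ x)"
      by (rule sum.swap)
    also have "\<dots> = f \<bullet> (S *v g)"
      by (simp add: inner_vec_def matrix_vector_mult_def sum_distrib_left sym mult_ac)
    finally show ?thesis .
  qed
  obtain B where B: "pairwise orthogonal B" "\<And>b. b \<in> B \<Longrightarrow> norm b = 1"
      "\<And>b. b \<in> B \<Longrightarrow> \<exists>c. S *v b = c *\<^sub>R b" "finite B" "card B = DIM(real^'v)"
    using selfadjoint_orthonormal_eigenbasis[of "(*v) S"] selfadj
      matrix_vector_mul_linear by blast
  have "card B = card (UNIV :: 'v set)" using B by simp
  then obtain u where u: "bij_betw u (UNIV :: 'v set) B"
    using B(4) by (metis finite_class.finite_UNIV finite_same_card_bij)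
  have uB: "u i \<in> B" for i using u by (auto simp: bij_betw_def)
  have "\<forall>i. \<exists>c. S *v u i = c *\<^sub>R u i" using B(3) uB by blast
  then obtain d where d: "\<And>i. S *v u i = d i *\<^sub>R u i" by metis
  define \<phi> where "\<phi> i = (\<chi> x. u i $ x / sqrt (\<pi> x))" for i
  have orth: "u i \<bullet> u j = (if i = j then 1 else 0)" for i j
  proof (cases "i = j")
    case True
    then show ?thesis using B(2)[OF uB] by (simp add: norm_eq_1)
  next
    case False
    then have "u i \<noteq> u j" using u by (auto simp: bij_betw_def inj_on_def)
    then have "orthogonal (u i) (u j)" using pairwiseD[OF B(1) uB uB] by blast
    then show ?thesis using False by (simp add: orthogonal_def)
  qed
  show thesis
  proof (rule that)
    fix i j
    have "\<pi> x * (a / sqrt (\<pi> x)) * (b / sqrt (\<pi> x)) = a * b" for x a b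
      using pos[of x] pos'[of x] sq[of x] by (simp add: field_simps)
    then have "weighted_inner \<pi> (\<phi> i) (\<phi> j) = u i \<bullet> u j"
      by (simp add: weighted_inner_def \<phi>_def inner_vec_def)
    then show "weighted_inner \<pi> (\<phi> i) (\<phi> j) = (if i = j then 1 else 0)"
      by (simp add: orth)
  next
    fix i
    show "Q *v \<phi> i = d i *\<^sub>R \<phi> i"
    proof (rule vec_eq_iff[THEN iffD2], intro allI)
      fix x
      have "sqrt (\<pi> x) * (Q *v \<phi> i) $ x = (S *v u i) $ x"
        by (simp add: matrix_vector_mult_def \<phi>_def S_def sum_distrib_left mult_ac)
      also have "\<dots> = d i * u i $ x" by (simp add: d)
      also have "\<dots> = sqrt (\<pi> x) * (d i *\<^sub>R \<phi> i) $ x"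
        using pos[of x] by (simp add: \<phi>_def)
      finally show "(Q *v \<phi> i) $ x = (d i *\<^sub>R \<phi> i) $ x"
        using pos[of x] by simp
    qed
  qed
qed

text \<open>
  With $R$ the matrix whose columns are the eigenvectors, $(X I - Q) R = R D$ for a diagonal matrix $D$
  with entries $X - d_i$. This is an identity of matrices over the polynomial ring, where $\det R$ can
  be cancelled because the weighted orthogonality relations provide a left inverse of $R$.
\<close>

lemma charpoly_eigenbasis:
  fixes Q :: "real^'v::finite^'v" and \<phi> :: "'v \<Rightarrow> real^'v"
  assumes ortho: "\<And>i j. weighted_inner \<pi> (\<phi> i) (\<phi> j) = (if i = j then 1 else 0)"
    and eigen: "\<And>i. Q *v \<phi> i = d i *\<^sub>R \<phi> i"
  shows "charpoly Q = (\<Prod>i\<in>UNIV. [:- d i, 1:])"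
proof -
  define R :: "real poly^'v^'v" where "R = (\<chi> x i. [:\<phi> i $ x:])"
  define L :: "real poly^'v^'v" where "L = (\<chi> i x. [:\<pi> x * \<phi> i $ x:])"
  define A :: "real poly^'v^'v" where "A = mat [:0, 1:] - (\<chi> i j. [:Q $ i $ j:])"
  define D :: "real poly^'v^'v" where "D = (\<chi> i j. if i = j then [:- d i, 1:] else 0)"
  have const_sum: "(\<Sum>x\<in>X. [:g x:]) = [:\<Sum>x\<in>X. g x:]" for X :: "'v set" and g :: "'v \<Rightarrow> real"
    by (induction X rule: infinite_finite_induct) auto
  have "L ** R = mat 1"
    using ortho
    by (auto simp: vec_eq_iff mult_ac matrix_matrix_mult_def L_def R_def mat_def const_sum
        weighted_inner_def one_pCons)
  then have "det L * det R = 1" by (metis det_mul det_I)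
  then have nz: "det R \<noteq> 0" by auto
  have "A ** R = R ** D"
  proof (rule vec_eq_iff[THEN iffD2], intro allI, rule vec_eq_iff[THEN iffD2], intro allI)
    fix x i
    have *: "(\<Sum>y\<in>UNIV. Q $ x $ y * \<phi> i $ y) = d i * \<phi> i $ x"
      using eigen[of i] by (auto simp: vec_eq_iff matrix_vector_mult_def)
    have "(A ** R) $ x $ i
        = (\<Sum>y\<in>UNIV. (if x = y then [:0, \<phi> i $ y:] else 0)) - (\<Sum>y\<in>UNIV. [:Q $ x $ y * \<phi> i $ y:])"
      unfolding sum_subtractf[symmetric]
      by (auto simp: matrix_matrix_mult_def A_def R_def mat_def algebra_simps intro!: sum.cong)
    also have "\<dots> = [:- d i * \<phi> i $ x, \<phi> i $ x:]"
      by (simp add: const_sum *)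
    also have "\<dots> = (R ** D) $ x $ i"
      by (simp add: matrix_matrix_mult_def R_def D_def if_distrib[of "(*) _"] cong: if_cong)
    finally show "(A ** R) $ x $ i = (R ** D) $ x $ i" .
  qed
  then have "det A * det R = det D * det R" by (metis det_mul mult.commute)
  then have "det A = det D" using nz by simp
  also have "\<dots> = (\<Prod>i\<in>UNIV. [:- d i, 1:])"
    by (subst det_diagonal) (auto simp: D_def)
  finally show ?thesis by (simp add: charpoly_def A_def)
qed

lemma mset_eigenvalues_desc:
  fixes Q :: "real^'v::finite^'v"
  assumes "charpoly Q = (\<Prod>i\<in>UNIV. [:- d i, 1:])"
  shows "mset (eigenvalues_desc Q) = image_mset d (mset_set UNIV)"
proof -
  have lin: "proots [:- a, 1:] = {#a#}" for a :: real
    using order_power_n_n[of a 1] by (intro multiset_eqI) (auto simp: order_0I)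
  have "proots (charpoly Q) = (\<Sum>i\<in>UNIV. {#d i#})"
    unfolding assms by (subst proots_prod) (auto simp: lin)
  also have "\<dots> = image_mset d (mset_set UNIV)"
    by (simp add: sum_unfold_sum_mset)
  finally show ?thesis by (simp add: eigenvalues_desc_def)
qed

text \<open>
  The easy half of the min-max principle. If two eigenvalues exceeded $\beta$, some nonzero combination
  of their eigenvectors would have mean zero, and on it the Rayleigh quotient would exceed $\beta$.
\<close>

lemma second_eigenvalue_le:
  fixes Q :: "real^'v::finite^'v"
  assumes pos: "\<And>x. \<pi> x > 0" and rev: "reversible \<pi> Q" and two: "CARD('v) \<ge> 2"
    and poincare: "\<And>f. weighted_inner \<pi> f 1 = 0 \<Longrightarrow>
      weighted_inner \<pi> f (Q *v f) \<le> \<beta> * weighted_inner \<pi> f f"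
  shows "second_eigenvalue Q \<le> \<beta>"
proof (rule ccontr)
  assume "\<not> second_eigenvalue Q \<le> \<beta>"
  then have second: "eigenvalues_desc Q ! 1 > \<beta>" by (simp add: second_eigenvalue_def)
  obtain \<phi> :: "'v \<Rightarrow> real^'v" and d
    where ortho: "\<And>i j. weighted_inner \<pi> (\<phi> i) (\<phi> j) = (if i = j then 1 else 0)"
      and eigen: "\<And>i. Q *v \<phi> i = d i *\<^sub>R \<phi> i"
    using reversible_eigenbasis[OF pos rev] by blast
  let ?es = "eigenvalues_desc Q"
  have es: "mset ?es = image_mset d (mset_set UNIV)"
    by (rule mset_eigenvalues_desc[OF charpoly_eigenbasis[OF ortho eigen]])
  then have "size (mset ?es) = CARD('v)" by simp
  then have len: "length ?es \<ge> 2" using two by simp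
  have "sorted (rev ?es)" by (simp add: eigenvalues_desc_def)
  then have "?es ! 1 \<le> ?es ! 0" using len by (simp add: sorted_rev_nth_mono)
  have "2 \<le> length (filter (\<lambda>a. a > \<beta>) ?es)"
  proof -
    obtain a b l where abl: "?es = a # b # l"
      using len by (metis One_nat_def Suc_1 Suc_le_length_iff)
    then show ?thesis using second \<open>?es ! 1 \<le> ?es ! 0\<close> by simp
  qed
  also have "\<dots> = size (filter_mset (\<lambda>a. a > \<beta>) (mset ?es))" by (metis mset_filter size_mset)
  also have "\<dots> = card {i. d i > \<beta>}" by (simp add: es filter_mset_image_mset)
  finally obtain i j where ij: "i \<noteq> j" "d i > \<beta>" "d j > \<beta>"
    by (metis (mono_tags, lifting) card_2_iff' card_le_Suc0_iff_eq finite mem_Collect_eq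
        not_less_eq_eq numeral_2_eq_2)
  define a where "a = weighted_inner \<pi> (\<phi> i) 1"
  define b where "b = weighted_inner \<pi> (\<phi> j) 1"
  obtain s t where st: "s * a + t * b = 0" "s \<noteq> 0 \<or> t \<noteq> 0"
  proof (cases "a = 0")
    case True
    then show thesis using that[of 1 0] by simp
  next
    case False
    then show thesis using that[of b "- a"] by simp
  qed
  define f where "f = s *\<^sub>R \<phi> i + t *\<^sub>R \<phi> j"
  have "weighted_inner \<pi> f 1 = 0"
    using st by (simp add: f_def weighted_inner_simps a_def b_def)
  from poincare[OF this] have "s\<^sup>2 * d i + t\<^sup>2 * d j \<le> \<beta> * (s\<^sup>2 + t\<^sup>2)"
    using ij(1) ij(1)[symmetric]
    by (simp add: f_def matrix_vector_right_distrib matrix_vector_mult_scaleR eigen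
        weighted_inner_simps ortho power2_eq_square mult_ac)
  then have "s\<^sup>2 * (d i - \<beta>) + t\<^sup>2 * (d j - \<beta>) \<le> 0" by (simp add: algebra_simps)
  moreover have "s\<^sup>2 * (d i - \<beta>) \<ge> 0" "t\<^sup>2 * (d j - \<beta>) \<ge> 0" using ij by auto
  ultimately have "s\<^sup>2 * (d i - \<beta>) = 0" "t\<^sup>2 * (d j - \<beta>) = 0" by linarith+
  then show False using st ij by auto
qed

section \<open>From a Poincare inequality to the mixing time\<close>

lemma weighted_form_expand:
  "weighted_inner \<pi> f (Q *v g) = (\<Sum>x\<in>UNIV. \<Sum>y\<in>UNIV. \<pi> x * Q $ x $ y * f $ x * g $ y)"
  by (simp add: weighted_inner_def matrix_vector_mult_def sum_distrib_left mult_ac)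

lemma reversible_selfadjoint:
  assumes "reversible \<pi> Q"
  shows "weighted_inner \<pi> f (Q *v g) = weighted_inner \<pi> (Q *v f) g"
proof -
  have "weighted_inner \<pi> f (Q *v g)
      = (\<Sum>x\<in>UNIV. \<Sum>y\<in>UNIV. \<pi> y * Q $ y $ x * f $ x * g $ y)"
    unfolding weighted_form_expand using assms by (simp add: reversible_def)
  also have "\<dots> = (\<Sum>y\<in>UNIV. \<Sum>x\<in>UNIV. \<pi> y * Q $ y $ x * g $ y * f $ x)"
    by (subst sum.swap) (simp add: mult_ac)
  also have "\<dots> = weighted_inner \<pi> (Q *v f) g"
    by (simp only: weighted_form_expand weighted_inner_commute[of \<pi> "Q *v f" g])
  finally show ?thesis .
qed

lemma stochastic_mult_one:
  assumes "transition_matrix Q"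
  shows "Q *v 1 = 1"
  using assms by (simp add: transition_matrix_def matrix_vector_mult_def vec_eq_iff)

text \<open>
  The values $s = -1$ and $s = 1$ matter: they give the Dirichlet form $\langle f, (I - Q) f\rangle$
  and the form $\langle f, (I + Q) f\rangle$, respectively.
\<close>

lemma reversible_square_sum:
  assumes "transition_matrix Q" and "reversible \<pi> Q"
  shows "(\<Sum>x\<in>UNIV. \<Sum>y\<in>UNIV. \<pi> x * Q $ x $ y * (f $ x + s * f $ y)\<^sup>2)
    = (1 + s\<^sup>2) * weighted_inner \<pi> f f + 2 * s * weighted_inner \<pi> f (Q *v f)"
proof -
  have row: "(\<Sum>y\<in>UNIV. Q $ x $ y) = 1" for x
    using assms by (simp add: transition_matrix_def)
  have left: "(\<Sum>x\<in>UNIV. \<Sum>y\<in>UNIV. \<pi> x * Q $ x $ y * (f $ x)\<^sup>2) = weighted_inner \<pi> f f"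
    using row
    by (simp add: weighted_inner_def power2_eq_square mult_ac
        flip: sum_distrib_left sum_distrib_right)
  have "(\<Sum>x\<in>UNIV. \<Sum>y\<in>UNIV. \<pi> x * Q $ x $ y * (f $ y)\<^sup>2)
      = (\<Sum>x\<in>UNIV. \<Sum>y\<in>UNIV. \<pi> y * Q $ y $ x * (f $ y)\<^sup>2)"
    using assms by (simp add: reversible_def)
  also have "\<dots> = weighted_inner \<pi> f f"
    by (subst sum.swap) (rule left)
  finally have right: "(\<Sum>x\<in>UNIV. \<Sum>y\<in>UNIV. \<pi> x * Q $ x $ y * (f $ y)\<^sup>2) = weighted_inner \<pi> f f" .
  have "(\<Sum>x\<in>UNIV. \<Sum>y\<in>UNIV. \<pi> x * Q $ x $ y * (f $ x + s * f $ y)\<^sup>2)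
      = (\<Sum>x\<in>UNIV. \<Sum>y\<in>UNIV. \<pi> x * Q $ x $ y * (f $ x)\<^sup>2
          + s\<^sup>2 * (\<pi> x * Q $ x $ y * (f $ y)\<^sup>2)
          + 2 * s * (\<pi> x * Q $ x $ y * f $ x * f $ y))"
    by (intro sum.cong refl) (simp add: power2_eq_square algebra_simps)
  also have "\<dots> = weighted_inner \<pi> f f + s\<^sup>2 * weighted_inner \<pi> f f
      + 2 * s * weighted_inner \<pi> f (Q *v f)"
    by (simp add: sum.distrib left right weighted_form_expand flip: sum_distrib_left)
  finally show ?thesis by (simp add: algebra_simps)
qed

lemma dirichlet_form:
  assumes "transition_matrix Q" and "reversible \<pi> Q"
  shows "(\<Sum>x\<in>UNIV. \<Sum>y\<in>UNIV. \<pi> x * Q $ x $ y * (f $ x - f $ y)\<^sup>2) / 2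
    = weighted_inner \<pi> f f - weighted_inner \<pi> f (Q *v f)"
  using reversible_square_sum[OF assms, of f "- 1"] by simp

text \<open>
  The mean minimises the mean square deviation. This turns the variance into deviations from the
  value at one fixed vertex, which paths leading to that vertex can control.
\<close>

lemma weighted_variance_le:
  assumes total: "(\<Sum>x\<in>UNIV. \<pi> x) = 1" and mean: "weighted_inner \<pi> f 1 = 0"
  shows "weighted_inner \<pi> f f \<le> (\<Sum>x\<in>UNIV. \<pi> x * (f $ x - a)\<^sup>2)"
proof -
  have "(\<Sum>x\<in>UNIV. \<pi> x * (f $ x - a)\<^sup>2)
      = (\<Sum>x\<in>UNIV. \<pi> x * f $ x * f $ x - 2 * a * (\<pi> x * f $ x * 1 $ x) + a\<^sup>2 * \<pi> x)"
    by (intro sum.cong refl) (simp add: power2_eq_square algebra_simps)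
  also have "\<dots> = weighted_inner \<pi> f f - 2 * a * weighted_inner \<pi> f 1 + a\<^sup>2"
    using total
    by (simp add: weighted_inner_def sum.distrib sum_subtractf flip: sum_distrib_left)
  finally show ?thesis using mean by simp
qed

text \<open>
  The diagonal terms alone of $\sum_{x,y} \pi(x) Q(x,y) (f(x) + f(y))^2
  = 2 \langle f, f\rangle + 2 \langle f, Q f\rangle$ amount to at least $2 \langle f, f\rangle$ if $Q$
  is lazy. Laziness thus excludes negative eigenvalues, so that the second eigenvalue governs the speed of
  convergence.
\<close>

lemma lazy_form_nonneg:
  assumes pos: "\<And>x. \<pi> x > 0" and Q: "Q \<in> lazy_reversible_chains G \<pi>"
  shows "0 \<le> weighted_inner \<pi> f (Q *v f)"
proof -
  have tm: "transition_matrix Q" and rev: "reversible \<pi> Q" and lz: "\<And>x. Q $ x $ x \<ge> 1 / 2"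
    using Q by (auto simp: lazy_reversible_chains_def lazy_def)
  have Q0: "Q $ x $ y \<ge> 0" for x y using tm by (simp add: transition_matrix_def)
  have "2 * weighted_inner \<pi> f f = (\<Sum>x\<in>UNIV. \<pi> x * (1 / 2) * (f $ x + 1 * f $ x)\<^sup>2)"
    by (simp add: weighted_inner_def sum_distrib_left power2_eq_square algebra_simps)
  also have "\<dots> \<le> (\<Sum>x\<in>UNIV. \<pi> x * Q $ x $ x * (f $ x + 1 * f $ x)\<^sup>2)"
    using lz pos by (intro sum_mono mult_right_mono mult_left_mono) (auto simp: less_imp_le)
  also have "\<dots> \<le> (\<Sum>x\<in>UNIV. \<Sum>y\<in>UNIV. \<pi> x * Q $ x $ y * (f $ x + 1 * f $ y)\<^sup>2)"
    using pos Q0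
    by (intro sum_mono member_le_sum[where f = "\<lambda>y. \<pi> _ * Q $ _ $ y * (f $ _ + 1 * f $ y)\<^sup>2"])
      (auto simp: less_imp_le)
  also have "\<dots> = 2 * weighted_inner \<pi> f f + 2 * weighted_inner \<pi> f (Q *v f)"
    using reversible_square_sum[OF tm rev, of f 1] by simp
  finally show ?thesis by simp
qed

lemma mean_zero_mult:
  assumes "transition_matrix Q" "reversible \<pi> Q" "weighted_inner \<pi> f 1 = 0"
  shows "weighted_inner \<pi> (Q *v f) 1 = 0"
  using assms by (simp add: stochastic_mult_one flip: reversible_selfadjoint)

text \<open>
  A bound on the quadratic form of $Q$ becomes a bound on the norm of $Q f$ through Cauchy--Schwarz for
  the positive semidefinite form $\langle f, Q g\rangle$, applied to $f$ and $g = Q f$: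
  $\|g\|^4 = \langle f, Q g\rangle^2 \le \langle f, Q f\rangle \langle g, Q g\rangle
  \le \beta^2 \|f\|^2 \|g\|^2$.
\<close>

lemma lazy_contraction:
  assumes pos: "\<And>x. \<pi> x > 0" and Q: "Q \<in> lazy_reversible_chains G \<pi>" and "0 \<le> \<beta>"
    and poincare: "\<And>f. weighted_inner \<pi> f 1 = 0 \<Longrightarrow>
      weighted_inner \<pi> f (Q *v f) \<le> \<beta> * weighted_inner \<pi> f f"
    and mean: "weighted_inner \<pi> f 1 = 0"
  shows "weighted_inner \<pi> (Q *v f) (Q *v f) \<le> \<beta>\<^sup>2 * weighted_inner \<pi> f f"
proof -
  have tm: "transition_matrix Q" and rev: "reversible \<pi> Q"
    using Q by (auto simp: lazy_reversible_chains_def)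
  define g where "g = Q *v f"
  let ?N = "weighted_inner \<pi> g g" and ?M = "weighted_inner \<pi> f f"
  have N0: "?N \<ge> 0" and M0: "?M \<ge> 0"
    unfolding weighted_inner_def
    by (auto intro!: sum_nonneg simp: mult.assoc less_imp_le[OF pos])
  have "?N\<^sup>2 \<le> weighted_inner \<pi> f (Q *v f) * weighted_inner \<pi> g (Q *v g)"
  proof (rule discriminant_le_of_nonneg)
    fix t :: real
    have "0 \<le> weighted_inner \<pi> (f + t *\<^sub>R g) (Q *v (f + t *\<^sub>R g))"
      by (rule lazy_form_nonneg[OF pos Q])
    moreover have "weighted_inner \<pi> f (Q *v g) = ?N" "weighted_inner \<pi> g (Q *v f) = ?N"
      using reversible_selfadjoint[OF rev, of f g] by (simp_all add: g_def)
    ultimately show "0 \<le> weighted_inner \<pi> f (Q *v f) + 2 * ?N * t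
        + weighted_inner \<pi> g (Q *v g) * t\<^sup>2"
      by (simp add: matrix_vector_right_distrib matrix_vector_mult_scaleR weighted_inner_simps
          power2_eq_square algebra_simps)
  qed
  also have "\<dots> \<le> (\<beta> * ?M) * (\<beta> * ?N)"
    using poincare[OF mean] poincare[of g] mean_zero_mult[OF tm rev mean]
      lazy_form_nonneg[OF pos Q] \<open>0 \<le> \<beta>\<close> M0
    by (intro mult_mono) (auto simp: g_def)
  finally have "?N * ?N \<le> (\<beta>\<^sup>2 * ?M) * ?N" by (simp add: power2_eq_square mult_ac)
  then have "?N \<le> \<beta>\<^sup>2 * ?M"
    using N0 M0 by (cases "?N = 0") (auto simp: mult_le_cancel_right)
  then show ?thesis by (simp add: g_def)
qed

text \<open>
  For fixed $y$ the function $F_t(x) = Q^t(x,y)/\pi(y) - 1$ has mean zero and satisfies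
  $F_{t+1} = Q F_t$, so its squared norm, initially $1/\pi(y) - 1$, shrinks by $\beta^2$ in every step.
  A point $x$ has mass $\pi(x)$ in this norm, hence $|F_t(x)| \le \beta^t / \sqrt{\pi(x) \pi(y)}$.
\<close>

lemma uniform_dist_to_eq_decay:
  assumes \<pi>: "\<pi> \<in> pos_distributions" and Q: "Q \<in> lazy_reversible_chains G \<pi>" and "0 \<le> \<beta>"
    and poincare: "\<And>f. weighted_inner \<pi> f 1 = 0 \<Longrightarrow>
      weighted_inner \<pi> f (Q *v f) \<le> \<beta> * weighted_inner \<pi> f f"
    and m: "0 < m" "\<And>x. m \<le> \<pi> x"
  shows "uniform_dist_to_eq Q \<pi> t \<le> \<beta> ^ t / m"
proof -
  have pos: "\<And>x. \<pi> x > 0" and total: "(\<Sum>x\<in>UNIV. \<pi> x) = 1"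
    using \<pi> by (auto simp: pos_distributions_def)
  have tm: "transition_matrix Q" and rev: "reversible \<pi> Q"
    using Q by (auto simp: lazy_reversible_chains_def)
  have "\<bar>matrix_power Q t $ x $ y / \<pi> y - 1\<bar> \<le> \<beta> ^ t / m" for x y
  proof -
    define F where "F t = (\<chi> x. matrix_power Q t $ x $ y / \<pi> y - 1)" for t
    have step: "F (Suc t) = Q *v F t" for t
      using tm
      by (simp add: F_def vec_eq_iff matrix_matrix_mult_def matrix_vector_mult_def right_diff_distrib
          sum_subtractf sum_divide_distrib transition_matrix_def)
    have F0: "F 0 $ x = (if x = y then 1 / \<pi> y else 0) - 1" for x
      by (simp add: F_def mat_def)
    have mean: "weighted_inner \<pi> (F t) 1 = 0" for t
    proof (induction t)
      case 0
      have "weighted_inner \<pi> (F 0) 1 = (\<Sum>x\<in>UNIV. (if x = y then 1 else 0) - \<pi> x)"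
        unfolding weighted_inner_def
        by (intro sum.cong) (auto simp: F0 algebra_simps pos less_imp_neq[OF pos, symmetric])
      then show ?case by (simp add: sum_subtractf total)
    next
      case (Suc t)
      then show ?case unfolding step by (rule mean_zero_mult[OF tm rev])
    qed
    have decay: "weighted_inner \<pi> (F t) (F t) \<le> (\<beta> ^ t)\<^sup>2 / \<pi> y" for t
    proof (induction t)
      case 0
      have "weighted_inner \<pi> (F 0) (F 0)
          = (\<Sum>x\<in>UNIV. (if x = y then 1 / \<pi> y - 2 else 0) + \<pi> x)"
        unfolding weighted_inner_def
        by (intro sum.cong) (auto simp: F0 field_simps less_imp_neq[OF pos, symmetric])
      then show ?case by (simp add: sum.distrib total)
    next
      case (Suc t)
      have "weighted_inner \<pi> (F (Suc t)) (F (Suc t)) \<le> \<beta>\<^sup>2 * weighted_inner \<pi> (F t) (F t)"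
        unfolding step by (rule lazy_contraction[OF pos Q \<open>0 \<le> \<beta>\<close> poincare mean])
      also have "\<dots> \<le> \<beta>\<^sup>2 * ((\<beta> ^ t)\<^sup>2 / \<pi> y)"
        using Suc by (intro mult_left_mono) auto
      finally show ?case by (simp add: power_mult_distrib)
    qed
    have "\<pi> x * F t $ x * F t $ x \<le> weighted_inner \<pi> (F t) (F t)"
      unfolding weighted_inner_def
      by (intro member_le_sum) (auto simp: mult.assoc less_imp_le[OF pos])
    then have "\<pi> x * (F t $ x)\<^sup>2 \<le> (\<beta> ^ t)\<^sup>2 / \<pi> y"
      using decay[of t] by (simp add: power2_eq_square mult_ac)
    then have "(F t $ x)\<^sup>2 \<le> (\<beta> ^ t)\<^sup>2 / (\<pi> x * \<pi> y)"
      using pos[of x] pos[of y] by (simp add: field_simps)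
    also have "\<dots> \<le> (\<beta> ^ t)\<^sup>2 / (m * m)"
      using m pos by (intro divide_left_mono mult_mono mult_pos_pos) (auto simp: less_imp_le)
    finally have "(F t $ x)\<^sup>2 \<le> (\<beta> ^ t / m)\<^sup>2"
      by (simp add: power_divide power2_eq_square)
    then have "\<bar>F t $ x\<bar> \<le> \<beta> ^ t / m"
      using \<open>0 \<le> \<beta>\<close> m by (simp add: abs_le_square_iff[symmetric])
    then show ?thesis by (simp add: F_def)
  qed
  then show ?thesis unfolding uniform_dist_to_eq_def by (simp add: Max_le_iff)
qed

lemma mixing_time_le:
  assumes \<pi>: "\<pi> \<in> pos_distributions" and Q: "Q \<in> lazy_reversible_chains G \<pi>"
    and g: "0 < g" "g \<le> 1"
    and poincare: "\<And>f. weighted_inner \<pi> f 1 = 0 \<Longrightarrow>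
      weighted_inner \<pi> f (Q *v f) \<le> (1 - g) * weighted_inner \<pi> f f"
    and m: "0 < m" "\<And>x. m \<le> \<pi> x" and \<xi>: "0 < \<xi>"
  shows "mixing_time Q \<pi> \<xi> \<le> enat (nat \<lceil>ln (1 / (\<xi> * m)) / g\<rceil>)"
proof -
  define t where "t = nat \<lceil>ln (1 / (\<xi> * m)) / g\<rceil>"
  have "ln (1 / (\<xi> * m)) / g \<le> real t" unfolding t_def by (rule real_nat_ceiling_ge)
  then have t: "ln (1 / (\<xi> * m)) \<le> g * t" using g by (simp add: field_simps)
  have "(1 - g) ^ t \<le> exp (- g) ^ t"
    using g exp_ge_add_one_self[of "- g"] by (intro power_mono) auto
  also have "\<dots> = exp (- (g * t))" by (simp add: exp_of_nat_mult[symmetric] mult.commute)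
  also have "\<dots> \<le> exp (- ln (1 / (\<xi> * m)))" using t by simp
  also have "\<dots> = \<xi> * m" using m \<xi> by (simp add: ln_div exp_ln)
  finally have "(1 - g) ^ t / m \<le> \<xi>" using m by (simp add: field_simps)
  then have "uniform_dist_to_eq Q \<pi> t \<le> \<xi>"
    using uniform_dist_to_eq_decay[OF \<pi> Q _ poincare m, of t] g by auto
  then show ?thesis unfolding mixing_time_def t_def[symmetric] by (auto intro: INF_lower)
qed

section \<open>Averaging over the paths of a spanning tree\<close>

text \<open>
  The tree of shortest paths to $r$, encoded by its parent map $p$ and its depth function $h$. The root
  is its own parent, so every iterate of $p$ is total and $p^n$ is constantly $r$ as soon as $n$ is at
  least the height of the tree.
\<close>

lemma bfs_parent_map:
  fixes G :: "'v::finite pair_pre_digraph"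
  assumes G: "pair_graph G" and V: "pverts G = UNIV"
    and conn: "Digraph_Component.connected (with_proj G)"
  obtains p :: "'v \<Rightarrow> 'v" and h :: "'v \<Rightarrow> nat"
  where "p r = r" and "h r = 0"
    and "\<And>x. x \<noteq> r \<Longrightarrow> (p x, x) \<in> parcs G" and "\<And>x. x \<noteq> r \<Longrightarrow> h x = Suc (h (p x))"
    and "\<And>x. real (h x) \<le> graph_diam G"
proof -
  interpret pair_graph G by (rule G)
  have reach: "u \<rightarrow>\<^sup>*\<^bsub>with_proj G\<^esub> v" for u v
    using conn V reachable_mk_symmetric_eq[OF sym_arcs]
    by (auto simp: Digraph_Component.connected_def strongly_connected_def)
  have "\<exists>n::nat. graph_dist G u v = ereal (real n)" for u v
  proof -
    obtain q where "\<mu> (\<lambda>_. 1) u v = ereal (awalk_cost (\<lambda>_. 1) q)"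
      using min_cost_awalk[OF reach, of "\<lambda>_. 1"] by auto
    moreover have "awalk_cost (\<lambda>_. 1) q = real (length q)" by (induction q) auto
    ultimately show ?thesis by (auto simp: graph_dist_def)
  qed
  then obtain dist :: "'v \<Rightarrow> 'v \<Rightarrow> nat" where dist: "\<And>u v. graph_dist G u v = ereal (real (dist u v))"
    by metis
  have "real (dist u v) \<le> graph_diam G" for u v
  proof -
    let ?S = "SUP u\<in>pverts G. SUP v\<in>pverts G. graph_dist G u v"
    have ub: "?S \<le> ereal (real (Max (range (\<lambda>(u, v). dist u v))))"
      unfolding dist by (intro SUP_least) (auto intro!: Max_ge)
    have le: "ereal (real (dist u v)) \<le> ?S"
      unfolding dist V by (intro SUP_upper2[of u] SUP_upper2[of v]) auto
    have "\<bar>?S\<bar> \<noteq> \<infinity>"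
      using ub le by (cases ?S) auto
    then have "ereal (graph_diam G) = ?S"
      unfolding graph_diam_def by (rule ereal_real')
    then show ?thesis using le by (metis ereal_less_eq(3))
  qed
  moreover have "\<exists>u. (u, x) \<in> parcs G \<and> dist r x = Suc (dist r u)" if ne: "x \<noteq> r" for x
  proof -
    obtain u e where "\<mu> (\<lambda>_. 1) r x = \<mu> (\<lambda>_. 1) r u + ereal 1" "arc e (u, x)"
      using mu_exact_triangle_Ex[OF ne reach, of "\<lambda>_. 1"] by auto
    then have "(u, x) \<in> parcs G" "real (dist r x) = real (Suc (dist r u))"
      using dist[of r x] dist[of r u] by (auto simp: arc_def graph_dist_def)
    then show ?thesis unfolding of_nat_eq_iff by blast
  qed
  then obtain p where "\<And>x. x \<noteq> r \<Longrightarrow> (p x, x) \<in> parcs G \<and> dist r x = Suc (dist r (p x))"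
    by metis
  moreover have "dist r r = 0"
    using min_cost_le_walk_cost[of r "[]" r "\<lambda>_. 1"] dist[of r r] V
    by (simp add: graph_dist_def awalk_Nil_iff)
  ultimately show thesis
    using that[of "p(r := r)" "dist r"] by simp
qed

lemma funpow_parent_eq_root:
  assumes root: "p r = r" "h r = 0" and step: "\<And>x. x \<noteq> r \<Longrightarrow> h x = Suc (h (p x))"
    and "h x \<le> (n::nat)"
  shows "(p ^^ n) x = r"
  using \<open>h x \<le> n\<close>
proof (induction n arbitrary: x)
  case 0
  then show ?case using step[of x] by force
next
  case (Suc n)
  have "h (p x) \<le> n" using Suc.prems step[of x] root by (cases "x = r") auto
  then show ?case using Suc.IH by (simp add: funpow_swap1)
qed

text \<open>
  The law of $p^K(X)$, where $X$ has law $\pi$ and $K$ is independent of $X$ and uniform on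
  $\{0, \dots, n-1\}$. In other words, the tree edge from $z$ to $p(z)$ gets the probability that it is the
  edge met at a uniformly chosen step of the path from a $\pi$-random vertex to the root. After its
  arrival the path rests at the root, and these steps count as loops there; for this reason the total mass is
  exactly 1, whatever the depths.
\<close>

definition ancestor_law :: "('v::finite \<Rightarrow> real) \<Rightarrow> ('v \<Rightarrow> 'v) \<Rightarrow> nat \<Rightarrow> 'v \<Rightarrow> real" where
  "ancestor_law \<pi> p n z = (\<Sum>k<n. \<Sum>x\<in>UNIV. \<pi> x * of_bool ((p ^^ k) x = z)) / n"

lemma ancestor_law_nonneg: "(\<And>x. \<pi> x \<ge> 0) \<Longrightarrow> ancestor_law \<pi> p n z \<ge> 0"
  by (simp add: ancestor_law_def sum_nonneg)

lemma sum_ancestor_law: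
  "(\<Sum>z\<in>UNIV. ancestor_law \<pi> p n z * F z) = (\<Sum>k<n. \<Sum>x\<in>UNIV. \<pi> x * F ((p ^^ k) x)) / n"
proof -
  have "(\<Sum>z\<in>UNIV. ancestor_law \<pi> p n z * F z)
      = (\<Sum>z\<in>UNIV. \<Sum>k<n. \<Sum>x\<in>UNIV. \<pi> x * (of_bool ((p ^^ k) x = z) * F z)) / n"
    by (simp only: ancestor_law_def times_divide_eq_left sum_divide_distrib[symmetric]
        sum_distrib_right mult.assoc)
  also have "(\<Sum>z\<in>UNIV. \<Sum>k<n. \<Sum>x\<in>UNIV. \<pi> x * (of_bool ((p ^^ k) x = z) * F z))
      = (\<Sum>k<n. \<Sum>x\<in>UNIV. \<Sum>z\<in>UNIV. \<pi> x * (of_bool ((p ^^ k) x = z) * F z))"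
    by (subst sum.swap) (intro sum.cong refl sum.swap)
  also have "\<dots> = (\<Sum>k<n. \<Sum>x\<in>UNIV. \<pi> x * F ((p ^^ k) x))"
    by (simp flip: sum_distrib_left)
  finally show ?thesis .
qed

text \<open>
  Telescope along the path from $p^j(x)$ to the root and apply Cauchy--Schwarz. Since the bound does not
  depend on $j$, it serves every vertex of the path equally well.
\<close>

lemma path_to_root_bound:
  fixes f :: "'v \<Rightarrow> real"
  assumes root: "(p ^^ n) x = r" and "j \<le> n"
  shows "(f ((p ^^ j) x) - f r)\<^sup>2 \<le> n * (\<Sum>k<n. (f ((p ^^ k) x) - f (p ((p ^^ k) x)))\<^sup>2)"
proof -
  let ?g = "\<lambda>k. f ((p ^^ k) x) - f (p ((p ^^ k) x))"
  have "f ((p ^^ j) x) - f r = (\<Sum>k=j..<n. ?g k)"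
    using sum_Suc_diff'[OF \<open>j \<le> n\<close>, of "\<lambda>k. - f ((p ^^ k) x)"] root by simp
  then have "(f ((p ^^ j) x) - f r)\<^sup>2 = (\<Sum>k=j..<n. 1 * ?g k)\<^sup>2" by simp
  also have "\<dots> \<le> (\<Sum>k=j..<n. 1\<^sup>2) * (\<Sum>k=j..<n. (?g k)\<^sup>2)"
    by (rule Cauchy_Schwarz_ineq_sum)
  also have "\<dots> \<le> n * (\<Sum>k<n. (?g k)\<^sup>2)"
    by (intro mult_mono sum_mono2 sum_nonneg) auto
  finally show ?thesis .
qed

text \<open>
  The factor $n^2$ is the length $n$ lost in Cauchy--Schwarz times the $n$ from the average over the
  steps of the path. The three bounds concern a vertex drawn from $\pi$ and the two ends of a random
  tree edge: a single energy controls all the pieces of the perturbed distribution.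
\<close>

lemma ancestor_path_bounds:
  fixes \<pi> :: "'v::finite \<Rightarrow> real" and f :: "'v \<Rightarrow> real"
  assumes nonneg: "\<And>x. \<pi> x \<ge> 0" and "n \<ge> 1" and root: "\<And>x. (p ^^ n) x = r"
  defines "B \<equiv> (real n)\<^sup>2 * (\<Sum>z\<in>UNIV. ancestor_law \<pi> p n z * (f z - f (p z))\<^sup>2)"
  shows "(\<Sum>x\<in>UNIV. \<pi> x * (f x - f r)\<^sup>2) \<le> B"
    and "(\<Sum>z\<in>UNIV. ancestor_law \<pi> p n z * (f z - f r)\<^sup>2) \<le> B"
    and "(\<Sum>z\<in>UNIV. ancestor_law \<pi> p n z * (f (p z) - f r)\<^sup>2) \<le> B"
proof -
  have B: "B = (\<Sum>x\<in>UNIV. \<pi> x * (n * (\<Sum>k<n. (f ((p ^^ k) x) - f (p ((p ^^ k) x)))\<^sup>2)))"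
  proof -
    have "B = n * (\<Sum>k<n. \<Sum>x\<in>UNIV. \<pi> x * (f ((p ^^ k) x) - f (p ((p ^^ k) x)))\<^sup>2)"
      using \<open>n \<ge> 1\<close> unfolding B_def sum_ancestor_law by (simp add: power2_eq_square)
    also have "\<dots> = n * (\<Sum>x\<in>UNIV. \<Sum>k<n. \<pi> x * (f ((p ^^ k) x) - f (p ((p ^^ k) x)))\<^sup>2)"
      by (subst sum.swap) simp
    finally show ?thesis by (simp add: sum_distrib_left mult_ac)
  qed
  have level: "(\<Sum>x\<in>UNIV. \<pi> x * (f ((p ^^ j) x) - f r)\<^sup>2) \<le> B" if "j \<le> n" for j
    unfolding B using nonneg path_to_root_bound[OF root that]
    by (intro sum_mono mult_left_mono) auto
  show "(\<Sum>x\<in>UNIV. \<pi> x * (f x - f r)\<^sup>2) \<le> B"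
    using level[of 0] by simp
  have average: "(\<Sum>k<n. a k) / n \<le> B" if "\<And>k. k < n \<Longrightarrow> a k \<le> B" for a :: "nat \<Rightarrow> real"
    using sum_bounded_above[of "{..<n}" a B] that \<open>n \<ge> 1\<close> by (simp add: field_simps)
  show "(\<Sum>z\<in>UNIV. ancestor_law \<pi> p n z * (f z - f r)\<^sup>2) \<le> B"
    unfolding sum_ancestor_law by (intro average level) simp
  show "(\<Sum>z\<in>UNIV. ancestor_law \<pi> p n z * (f (p z) - f r)\<^sup>2) \<le> B"
    unfolding sum_ancestor_law using level[of "Suc _"] by (intro average) auto
qed

section \<open>Reinforcing a chain along the tree\<close>

lemma chain_of_conductances:
  fixes c :: "'v::finite \<Rightarrow> 'v \<Rightarrow> real"
  assumes sym: "\<And>x y. c x y = c y x" and nonneg: "\<And>x y. c x y \<ge> 0"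
    and row: "\<And>x. (\<Sum>y\<in>UNIV. c x y) = \<pi> x" and pos: "\<And>x. \<pi> x > 0"
    and diag: "\<And>x. c x x \<ge> \<pi> x / 2"
    and supp: "\<And>x y. c x y > 0 \<Longrightarrow> (x, y) \<in> parcs G \<or> x = y"
  shows "(\<chi> x y. c x y / \<pi> x) \<in> lazy_reversible_chains G \<pi>"
proof -
  have le: "c x y \<le> \<pi> x" for x y
    unfolding row[symmetric] by (rule member_le_sum) (auto simp: nonneg)
  have nz: "\<pi> x \<noteq> 0" for x using pos[of x] by simp
  have "0 \<le> c x y / \<pi> x" "c x y / \<pi> x \<le> 1" "1 / 2 \<le> c x x / \<pi> x"
    "c x y / \<pi> x > 0 \<longleftrightarrow> c x y > 0" for x y
    using le[of x y] nonneg[of x y] diag[of x] pos[of x]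
    by (auto simp: divide_le_eq_1 zero_less_divide_iff pos_le_divide_eq)
  then show ?thesis
    using supp nz sym
    by (auto simp: lazy_reversible_chains_def transition_matrix_def on_graph_def lazy_def
        reversible_def row simp flip: sum_divide_distrib)
qed

text \<open>
  The new chain is a mixture, given by its symmetric edge measure $c(x,y) = \pi'(x) Q(x,y)$. With weight
  $1 - \delta$ it is the edge measure of $P$; with weight $\delta$ it draws a random tree edge and then
  traverses it in a fair direction with probability $1/2$, or stays at one of its ends, chosen fairly,
  with probability $1/2$. The holding part makes the result lazy, and the marginal is
  $\pi' = (1 - \delta) \pi + \delta (\rho + \sigma) / 2$, with $\rho$ and $\sigma$ the laws of the two
  ends of a random tree edge.

  Let $W$ be the mean squared increment of $f$ along a random tree edge. Every component of $\pi'$ has mean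
  square deviation from $f(r)$ at most $n^2 W$, while the traversals alone contribute
  $\delta W / 4$ to the Dirichlet form. Comparing the two gives the constant $\delta / (4 n^2)$.
\<close>

lemma reinforced_chain:
  fixes \<pi> :: "'v::finite \<Rightarrow> real" and P :: "real^'v^'v"
  assumes \<pi>: "\<pi> \<in> pos_distributions" and P: "P \<in> lazy_reversible_chains G \<pi>"
    and \<delta>: "0 < \<delta>" "\<delta> < 1"
    and arcs: "\<And>x. p x = x \<or> (x, p x) \<in> parcs G \<and> (p x, x) \<in> parcs G"
    and n: "n \<ge> 1" and root: "\<And>x. (p ^^ n) x = r"
  obtains \<pi>' Q where "\<pi>' \<in> pos_distributions" "\<And>x. \<pi>' x \<ge> (1 - \<delta>) * \<pi> x"
    "Q \<in> lazy_reversible_chains G \<pi>'"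
    "\<And>x y. \<pi>' x * Q $ x $ y \<ge> (1 - \<delta>) * \<pi> x * P $ x $ y"
    "\<And>f. weighted_inner \<pi>' f 1 = 0 \<Longrightarrow>
      weighted_inner \<pi>' f (Q *v f) \<le> (1 - \<delta> / (4 * (real n)\<^sup>2)) * weighted_inner \<pi>' f f"
proof -
  have pos: "\<And>x. \<pi> x > 0" and total: "(\<Sum>x\<in>UNIV. \<pi> x) = 1"
    using \<pi> by (auto simp: pos_distributions_def)
  have P01: "\<And>x y. P $ x $ y \<ge> 0" and Prow: "\<And>x. (\<Sum>y\<in>UNIV. P $ x $ y) = 1"
    and Prev: "\<And>x y. \<pi> x * P $ x $ y = \<pi> y * P $ y $ x" and Plazy: "\<And>x. P $ x $ x \<ge> 1 / 2"
    and Psupp: "\<And>x y. P $ x $ y > 0 \<Longrightarrow> (x, y) \<in> parcs G \<or> x = y"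
    using P by (auto simp: lazy_reversible_chains_def transition_matrix_def reversible_def lazy_def
        on_graph_def)
  define \<rho> where "\<rho> = ancestor_law \<pi> p n"
  define J where "J x y = \<rho> x * of_bool (p x = y)" for x y
  define \<sigma> where "\<sigma> y = (\<Sum>x\<in>UNIV. J x y)" for y
  define \<pi>' where "\<pi>' x = (1 - \<delta>) * \<pi> x + \<delta> / 2 * (\<rho> x + \<sigma> x)" for x
  define c where "c x y = (1 - \<delta>) * \<pi> x * P $ x $ y
      + \<delta> / 4 * (J x y + J y x + of_bool (x = y) * (\<rho> x + \<sigma> x))" for x y
  define Q where "Q = (\<chi> x y. c x y / \<pi>' x)"
  have \<rho>0: "\<rho> x \<ge> 0" for x
    unfolding \<rho>_def by (rule ancestor_law_nonneg) (simp add: pos less_imp_le)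
  have J0: "J x y \<ge> 0" for x y by (simp add: J_def \<rho>0)
  have \<sigma>0: "\<sigma> x \<ge> 0" for x by (simp add: \<sigma>_def J0 sum_nonneg)
  have J_sum: "(\<Sum>y\<in>UNIV. J x y * F y) = \<rho> x * F (p x)" for x F
    by (simp add: J_def mult.assoc flip: sum_distrib_left)
  have \<sigma>_sum: "(\<Sum>y\<in>UNIV. \<sigma> y * F y) = (\<Sum>x\<in>UNIV. \<rho> x * F (p x))" for F
    unfolding \<sigma>_def sum_distrib_right by (subst sum.swap) (simp add: J_sum)
  have \<rho>_total: "(\<Sum>x\<in>UNIV. \<rho> x) = 1"
    using sum_ancestor_law[of \<pi> p n "\<lambda>_. 1"] total n by (simp add: \<rho>_def)
  have \<sigma>_total: "(\<Sum>x\<in>UNIV. \<sigma> x) = 1"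
    using \<sigma>_sum[of "\<lambda>_. 1"] \<rho>_total by simp
  have lower: "\<pi>' x \<ge> (1 - \<delta>) * \<pi> x" for x
    unfolding \<pi>'_def using \<delta> \<rho>0[of x] \<sigma>0[of x] by simp
  have pos': "\<pi>' x > 0" for x
    using lower[of x] pos[of x] \<delta> by (smt (verit) mult_pos_pos)
  have total': "(\<Sum>x\<in>UNIV. \<pi>' x) = 1"
  proof -
    have "(\<Sum>x\<in>UNIV. \<pi>' x) = (1 - \<delta>) * (\<Sum>x\<in>UNIV. \<pi> x)
        + \<delta> / 2 * ((\<Sum>x\<in>UNIV. \<rho> x) + (\<Sum>x\<in>UNIV. \<sigma> x))"
      by (simp only: \<pi>'_def sum.distrib flip: sum_distrib_left)
    then show ?thesis by (simp add: total \<rho>_total \<sigma>_total)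
  qed
  have dist': "\<pi>' \<in> pos_distributions" by (simp add: pos_distributions_def pos' total')
  have c_lower: "c x y \<ge> (1 - \<delta>) * \<pi> x * P $ x $ y" for x y
    unfolding c_def using \<delta> J0[of x y] J0[of y x] \<rho>0[of x] \<sigma>0[of x] by simp
  have row: "(\<Sum>y\<in>UNIV. c x y) = \<pi>' x" for x
  proof -
    have "(\<Sum>y\<in>UNIV. c x y) = (1 - \<delta>) * \<pi> x * (\<Sum>y\<in>UNIV. P $ x $ y)
       + \<delta> / 4 * ((\<Sum>y\<in>UNIV. J x y) + (\<Sum>y\<in>UNIV. J y x)
       + (\<Sum>y\<in>UNIV. of_bool (x = y) * (\<rho> x + \<sigma> x)))"
      by (simp only: c_def sum.distrib flip: sum_distrib_left)
    also have "\<dots> = (1 - \<delta>) * \<pi> x + \<delta> / 4 * (\<rho> x + \<sigma> x + (\<rho> x + \<sigma> x))"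
      using J_sum[of x "\<lambda>_. 1"] by (simp add: Prow \<sigma>_def[symmetric])
    finally show ?thesis by (simp add: \<pi>'_def)
  qed
  have chain: "Q \<in> lazy_reversible_chains G \<pi>'"
    unfolding Q_def
  proof (rule chain_of_conductances[OF _ _ row pos'])
    show "c x y = c y x" for x y using Prev[of x y] by (auto simp: c_def mult.assoc add.commute)
    have P': "0 \<le> (1 - \<delta>) * \<pi> x * P $ x $ y" for x y
      using \<delta> pos[of x] P01[of x y] by simp
    show "c x y \<ge> 0" for x y using c_lower[of x y] P'[of x y] by linarith
    show "c x x \<ge> \<pi>' x / 2" for x
    proof -
      have "(1 - \<delta>) * \<pi> x * (1 / 2) \<le> (1 - \<delta>) * \<pi> x * P $ x $ x"
        using \<delta> pos[of x] Plazy by (intro mult_left_mono) auto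
      moreover have "\<delta> / 4 * (J x x + J x x) \<ge> 0" using \<delta> J0 by simp
      moreover have "\<pi>' x / 2 = (1 - \<delta>) * \<pi> x * (1 / 2) + \<delta> / 4 * (\<rho> x + \<sigma> x)"
        by (simp add: \<pi>'_def field_simps)
      moreover have "c x x = (1 - \<delta>) * \<pi> x * P $ x $ x
          + \<delta> / 4 * (J x x + J x x) + \<delta> / 4 * (\<rho> x + \<sigma> x)"
        by (simp add: c_def distrib_left)
      ultimately show ?thesis by linarith
    qed
    show "(x, y) \<in> parcs G \<or> x = y" if "c x y > 0" for x y
    proof (rule ccontr)
      assume no: "\<not> ((x, y) \<in> parcs G \<or> x = y)"
      then have "J x y = 0" "J y x = 0" using arcs[of x] arcs[of y] by (auto simp: J_def)
      moreover have "P $ x $ y = 0" using no Psupp[of x y] P01[of x y] by fastforce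
      ultimately show False using that no by (simp add: c_def)
    qed
  qed
  have Qc: "\<pi>' x * Q $ x $ y = c x y" for x y
    using pos'[of x] by (simp add: Q_def)
  have tm: "transition_matrix Q" and rev: "reversible \<pi>' Q"
    using chain by (auto simp: lazy_reversible_chains_def)
  have poincare: "weighted_inner \<pi>' f (Q *v f) \<le> (1 - \<delta> / (4 * (real n)\<^sup>2)) * weighted_inner \<pi>' f f"
    if mean: "weighted_inner \<pi>' f 1 = 0" for f
  proof -
    define W where "W = (\<Sum>z\<in>UNIV. \<rho> z * (f $ z - f $ (p z))\<^sup>2)"
    have "weighted_inner \<pi>' f f \<le> (\<Sum>x\<in>UNIV. \<pi>' x * (f $ x - f $ r)\<^sup>2)"
      by (rule weighted_variance_le[OF total' mean])
    also have "\<dots> = (1 - \<delta>) * (\<Sum>x\<in>UNIV. \<pi> x * (f $ x - f $ r)\<^sup>2)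
        + \<delta> / 2 * ((\<Sum>x\<in>UNIV. \<rho> x * (f $ x - f $ r)\<^sup>2) + (\<Sum>x\<in>UNIV. \<rho> x * (f $ (p x) - f $ r)\<^sup>2))"
      unfolding \<sigma>_sum[of "\<lambda>x. (f $ x - f $ r)\<^sup>2", symmetric]
      by (simp only: sum_distrib_left flip: sum.distrib)
        (intro sum.cong refl, simp add: \<pi>'_def field_simps)
    also have "\<dots> \<le> (1 - \<delta>) * ((real n)\<^sup>2 * W) + \<delta> / 2 * ((real n)\<^sup>2 * W + (real n)\<^sup>2 * W)"
      unfolding W_def \<rho>_def using \<delta> pos
      by (intro add_mono mult_left_mono ancestor_path_bounds n root) (auto simp: less_imp_le)
    also have "\<dots> = (real n)\<^sup>2 * W" by (simp add: algebra_simps)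
    finally have var: "weighted_inner \<pi>' f f \<le> (real n)\<^sup>2 * W" .
    have "\<delta> / 4 * W = \<delta> / 4 * (\<Sum>x\<in>UNIV. \<Sum>y\<in>UNIV. (J x y + J y x) * (f $ x - f $ y)\<^sup>2) / 2"
    proof -
      have W: "(\<Sum>x\<in>UNIV. \<Sum>y\<in>UNIV. J x y * (f $ x - f $ y)\<^sup>2) = W"
        by (simp add: W_def J_sum)
      have "(\<Sum>x\<in>UNIV. \<Sum>y\<in>UNIV. J y x * (f $ x - f $ y)\<^sup>2)
          = (\<Sum>x\<in>UNIV. \<Sum>y\<in>UNIV. J x y * (f $ x - f $ y)\<^sup>2)"
        by (subst sum.swap) (simp add: power2_commute)
      with W show ?thesis by (simp add: distrib_right sum.distrib)
    qed
    also have "\<dots> = (\<Sum>x\<in>UNIV. \<Sum>y\<in>UNIV. \<delta> / 4 * (J x y + J y x) * (f $ x - f $ y)\<^sup>2) / 2"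
      by (simp add: sum_distrib_left mult.assoc)
    also have "\<dots> \<le> (\<Sum>x\<in>UNIV. \<Sum>y\<in>UNIV. \<pi>' x * Q $ x $ y * (f $ x - f $ y)\<^sup>2) / 2"
    proof (intro divide_right_mono sum_mono mult_right_mono)
      fix x y
      have "0 \<le> (1 - \<delta>) * \<pi> x * P $ x $ y" using \<delta> pos[of x] P01[of x y] by simp
      moreover have "0 \<le> \<delta> / 4 * (of_bool (x = y) * (\<rho> x + \<sigma> x))"
        using \<delta> \<rho>0[of x] \<sigma>0[of x] by simp
      ultimately show "\<delta> / 4 * (J x y + J y x) \<le> \<pi>' x * Q $ x $ y"
        by (simp add: Qc c_def distrib_left)
    qed auto
    also have "\<dots> = weighted_inner \<pi>' f f - weighted_inner \<pi>' f (Q *v f)"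
      by (rule dirichlet_form[OF tm rev])
    finally have energy: "\<delta> / 4 * W \<le> weighted_inner \<pi>' f f - weighted_inner \<pi>' f (Q *v f)" .
    have "\<delta> / (4 * (real n)\<^sup>2) * weighted_inner \<pi>' f f \<le> \<delta> / (4 * (real n)\<^sup>2) * ((real n)\<^sup>2 * W)"
      using var \<delta> by (intro mult_left_mono) auto
    also have "\<dots> = \<delta> / 4 * W" using n by simp
    finally show ?thesis using energy by (simp add: left_diff_distrib)
  qed
  show thesis
    using that[OF dist' lower chain _ poincare] c_lower by (simp add: Qc)
qed

theorem theorem2:
  fixes G :: "'v::finite pair_pre_digraph"
    and \<pi> :: "'v \<Rightarrow> real"
    and \<epsilon> :: real
    and P :: "real^'v^'v"
  assumes "pair_graph G"
    and "pverts G = UNIV"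
    and "Digraph_Component.connected (with_proj G)"
    and "CARD('v) \<ge> 2"
    and "\<pi> \<in> pos_distributions"
    and "0 < \<epsilon>" and "\<epsilon> < 1"
    and "P \<in> lazy_reversible_chains G \<pi>"
  shows "\<exists>\<pi>' \<in> perturbed_distributions \<pi> \<epsilon>. \<exists>Q \<in> lazy_reversible_chains G \<pi>'.
      spectral_gap Q \<ge> 1 / 12 * \<epsilon> * inverse ((graph_diam G)\<^sup>2)
    \<and> (\<forall>x y. (x, y) \<in> parcs G \<longrightarrow> \<pi>' x * Q $ x $ y \<ge> (1 - \<epsilon>) * \<pi> x * P $ x $ y)
    \<and> ereal_of_enat (mixing_time Q \<pi>' (1 / 4))
        \<le> ereal (24 * inverse \<epsilon> * (graph_diam G)\<^sup>2 * ln (16 * inverse (MIN x. \<pi> x)))"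
proof -
  interpret pair_graph G by (rule assms(1))
  note \<pi> = assms(5) and \<epsilon> = assms(6,7) and P = assms(8)
  have pos: "\<And>x. \<pi> x > 0" and total: "(\<Sum>x\<in>UNIV. \<pi> x) = 1"
    using \<pi> by (auto simp: pos_distributions_def)
  obtain r x0 :: 'v where "x0 \<noteq> r"
    using assms(4) by (metis (full_types) One_nat_def card_le_Suc0_iff_eq finite not_less_eq_eq numeral_2_eq_2)
  obtain p h where root: "p r = r" "h r = (0::nat)"
    and parent: "\<And>x. x \<noteq> r \<Longrightarrow> (p x, x) \<in> parcs G"
    and step: "\<And>x. x \<noteq> r \<Longrightarrow> h x = Suc (h (p x))"
    and depth: "\<And>x. real (h x) \<le> graph_diam G"
    using bfs_parent_map[OF assms(1-3), where r = r] by blast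
  define n where "n = Max (range h)"
  have hn: "h x \<le> n" for x unfolding n_def by (rule Max_ge) auto
  have n1: "n \<ge> 1" using hn[of x0] step[OF \<open>x0 \<noteq> r\<close>] by simp
  have "n \<in> range h" unfolding n_def by (rule Max_in) auto
  then have nD: "real n \<le> graph_diam G" using depth by auto
  define D where "D = graph_diam G"
  have D1: "D \<ge> 1" using n1 nD by (simp add: D_def)
  have arcs: "p x = x \<or> (x, p x) \<in> parcs G \<and> (p x, x) \<in> parcs G" for x
    using parent[of x] root arcs_symmetric[of "p x" x] by (cases "x = r") auto
  \<comment> \<open>perturbing by only half of the allowed amount keeps
    \<open>\<pi>'\<close> above \<open>\<pi> / 2\<close>, also when
    \<open>\<epsilon>\<close> is close to 1\<close>
  obtain \<pi>' Q where \<pi>': "\<pi>' \<in> pos_distributions" "\<And>x. \<pi>' x \<ge> (1 - \<epsilon> / 2) * \<pi> x"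
    and Q: "Q \<in> lazy_reversible_chains G \<pi>'"
    and edge: "\<And>x y. \<pi>' x * Q $ x $ y \<ge> (1 - \<epsilon> / 2) * \<pi> x * P $ x $ y"
    and poincare_n: "\<And>f. weighted_inner \<pi>' f 1 = 0 \<Longrightarrow>
      weighted_inner \<pi>' f (Q *v f) \<le> (1 - \<epsilon> / 2 / (4 * (real n)\<^sup>2)) * weighted_inner \<pi>' f f"
    using reinforced_chain[OF \<pi> P, of "\<epsilon> / 2" p n r] \<epsilon> arcs n1
      funpow_parent_eq_root[OF root step hn] by auto
  have pos': "\<pi>' x > 0" for x using \<pi>'(1) by (simp add: pos_distributions_def)
  define g where "g = \<epsilon> / (8 * D\<^sup>2)"
  have D2: "D\<^sup>2 \<ge> 1" using D1 by simp
  have "\<epsilon> * 1 \<le> 8 * D\<^sup>2" using \<epsilon> D2 by linarith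
  then have g: "0 < g" "g \<le> 1" using \<epsilon> D1 by (simp_all add: g_def)
  have poincare: "weighted_inner \<pi>' f (Q *v f) \<le> (1 - g) * weighted_inner \<pi>' f f"
    if "weighted_inner \<pi>' f 1 = 0" for f
  proof -
    have "g \<le> \<epsilon> / (8 * (real n)\<^sup>2)"
      unfolding g_def using nD n1 \<epsilon> D1
      by (intro divide_left_mono mult_left_mono power_mono mult_pos_pos) (auto simp: D_def)
    moreover have "weighted_inner \<pi>' f f \<ge> 0"
      unfolding weighted_inner_def
      by (auto intro!: sum_nonneg simp: mult.assoc less_imp_le[OF pos'])
    ultimately have "(1 - \<epsilon> / (8 * (real n)\<^sup>2)) * weighted_inner \<pi>' f f \<le> (1 - g) * weighted_inner \<pi>' f f"
      by (intro mult_right_mono) auto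
    then show ?thesis using poincare_n[OF that] by (simp add: mult.commute)
  qed
  have gap: "spectral_gap Q \<ge> 1 / 12 * \<epsilon> * inverse (D\<^sup>2)"
  proof -
    have "second_eigenvalue Q \<le> 1 - g"
      using Q assms(4) by (intro second_eigenvalue_le[OF pos' _ _ poincare])
        (auto simp: lazy_reversible_chains_def)
    moreover have "1 / 12 * \<epsilon> * inverse (D\<^sup>2) \<le> g"
      using \<epsilon> D2 by (simp add: g_def inverse_eq_divide) (intro divide_left_mono, auto)
    ultimately show ?thesis by (simp add: spectral_gap_def)
  qed
  have perturbed: "\<pi>' \<in> perturbed_distributions \<pi> \<epsilon>"
  proof -
    have "1 - \<epsilon> \<le> \<pi>' x / \<pi> x" for x
    proof -
      have "(1 - \<epsilon>) * \<pi> x \<le> (1 - \<epsilon> / 2) * \<pi> x"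
        using \<epsilon> pos[of x] by (intro mult_right_mono) auto
      then have "(1 - \<epsilon>) * \<pi> x \<le> \<pi>' x" using \<pi>'(2)[of x] by linarith
      then show ?thesis using pos[of x] by (simp add: pos_le_divide_eq)
    qed
    then show ?thesis using \<pi>'(1) by (simp add: perturbed_distributions_def)
  qed
  have edges: "\<pi>' x * Q $ x $ y \<ge> (1 - \<epsilon>) * \<pi> x * P $ x $ y" for x y
  proof -
    have "0 \<le> \<pi> x * P $ x $ y"
      using pos[of x] P by (simp add: lazy_reversible_chains_def transition_matrix_def less_imp_le)
    then have "(1 - \<epsilon>) * (\<pi> x * P $ x $ y) \<le> (1 - \<epsilon> / 2) * (\<pi> x * P $ x $ y)"
      using \<epsilon> by (intro mult_right_mono) auto
    then show ?thesis using edge[of x y] by (simp add: mult.assoc)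
  qed
  have mixing: "ereal_of_enat (mixing_time Q \<pi>' (1 / 4))
      \<le> ereal (24 * inverse \<epsilon> * D\<^sup>2 * ln (16 * inverse (MIN x. \<pi> x)))"
  proof -
    define m where "m = (MIN x. \<pi> x)"
    have m_in: "m \<in> range \<pi>" unfolding m_def by (rule Min_in) auto
    then have m0: "m > 0" using pos by auto
    have m_le: "m \<le> \<pi> x" for x unfolding m_def by (rule Min_le) auto
    have "m \<le> 1"
      using m_le[of r] member_le_sum[of r UNIV \<pi>] total pos by (auto simp: less_imp_le)
    have "m / 2 \<le> \<pi>' x" for x
    proof -
      have "1 / 2 * m \<le> (1 - \<epsilon> / 2) * \<pi> x"
        using \<epsilon> m0 m_le[of x] by (intro mult_mono) auto
      then show ?thesis using \<pi>'(2)[of x] by simp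
    qed
    then have "mixing_time Q \<pi>' (1 / 4) \<le> enat (nat \<lceil>ln (1 / (1 / 4 * (m / 2))) / g\<rceil>)"
      using m0 by (intro mixing_time_le[OF \<pi>'(1) Q g poincare]) auto
    then have "ereal_of_enat (mixing_time Q \<pi>' (1 / 4)) \<le> ereal_of_enat (enat (nat \<lceil>ln (8 / m) / g\<rceil>))"
      unfolding ereal_of_enat_le_iff by simp
    also have "\<dots> = ereal (real (nat \<lceil>ln (8 / m) / g\<rceil>))" by simp
    also have "real (nat \<lceil>ln (8 / m) / g\<rceil>) \<le> 24 * inverse \<epsilon> * D\<^sup>2 * ln (16 * inverse m)"
    proof -
      let ?L = "ln (16 * inverse m)"
      have "exp 1 \<le> 16 * inverse m"
        using exp_le one_le_inverse[OF m0 \<open>m \<le> 1\<close>] by linarith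
      then have L1: "?L \<ge> 1" using m0 by (simp add: ln_ge_iff)
      have "ln (8 / m) \<le> ?L" using m0 by (simp add: field_simps)
      have "0 \<le> ln (8 / m)" using m0 \<open>m \<le> 1\<close> by simp
      then have "real (nat \<lceil>ln (8 / m) / g\<rceil>) \<le> ln (8 / m) / g + 1"
        using g by (simp add: of_nat_nat)
      \<comment> \<open>rounding up costs at most 1, which is below
        \<open>?L / g\<close>\<close>
      also have "\<dots> \<le> ?L / g + ?L / g"
      proof (rule add_mono)
        show "ln (8 / m) / g \<le> ?L / g"
          using \<open>ln (8 / m) \<le> ?L\<close> g by (intro divide_right_mono) auto
        show "1 \<le> ?L / g" using L1 g by (simp add: field_simps)
      qed
      also have "\<dots> = 16 * inverse \<epsilon> * D\<^sup>2 * ?L"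
        using \<epsilon> D1 by (simp add: g_def field_simps)
      also have "\<dots> \<le> 24 * inverse \<epsilon> * D\<^sup>2 * ?L"
        using \<epsilon> L1 by (intro mult_right_mono) auto
      finally show ?thesis .
    qed
    finally show ?thesis by (simp add: m_def)
  qed
  show ?thesis
    using perturbed Q gap edges mixing unfolding D_def by blast
qed

end
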